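(* Let $p\in(0,1)$. For each $r>0$, let $K_1,K_2,\dots$ be i.i.d. $\mathrm{NegBin}(r,p)$ random variables and $U_1,U_2,\dots$ be i.i.d. $\mathrm{Uniform}(0,1)$ random variables, the two sequences being independent of each other, and let $X_i=K_i+U_i$ for all $i$. Define $$\hat p_n^{(\mathrm{R})}=\frac{\widehat{\mathrm{Median}}(X_1,X_2,\dots,X_n)-\frac13}{\widehat{\mathrm{Median}}(X_1,X_2,\dots,X_n)-\frac23+r}.$$ Then $\hat p_n^{(\mathrm{R})}$ converges in probability to $p$ as $n\to\infty$ and then $r\to\infty$; that is, for every $\varepsilon>0$, $$\lim_{r\to\infty}\limsup_{n\to\infty}\mathbb{P}\left(|\hat p_n^{(\mathrm{R})}-p|>\varepsilon\right)=0.$$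
   Context: For real $r>0$, $p\in(0,1)$ and $q=1-p$, $\mathrm{NegBin}(r,p)$ is the law on $\mathbb{N}_0=\{0,1,2,\dots\}$ with probability mass function $P_{r,p}(k)=\frac{\Gamma(r+k)}{\Gamma(r)\,k!}q^r p^k$. The median of a real random variable is $\mathrm{Median}(X)=\inf\{x\in\mathbb{R}:\mathbb{P}(X\le x)\ge\frac12\}$, and $\widehat{\mathrm{Median}}(X_1,\dots,X_n)$ denotes the sample median, i.e. the median of the empirical distribution of $X_1,\dots,X_n$. *)

theory Defs
  imports "HOL-Probability.Probability"
begin

text \<open>
  The mass function of the negative binomial law with real parameter \<open>r > 0\<close>, counting from 0.
  The library's \<^const>\<open>neg_binomial_pmf\<close> only covers integer \<open>r\<close>, and its probability parameter is
  \<open>1 - p\<close> in the notation used here.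
\<close>
definition neg_bin_mass :: "real \<Rightarrow> real \<Rightarrow> nat \<Rightarrow> real" where
  "neg_bin_mass r p k = Gamma (r + real k) / (Gamma r * fact k) * (1 - p) powr r * p ^ k"

lemma neg_bin_mass_nonneg:
  assumes "r > 0" "0 < p" "p < 1"
  shows "neg_bin_mass r p k \<ge> 0"
proof -
  have "Gamma (r + real k) > 0" "Gamma r > 0"
    using assms by (auto intro!: Gamma_real_pos)
  then show ?thesis
    using assms by (simp add: neg_bin_mass_def)
qed

lemma neg_bin_mass_sums:
  assumes "r > 0" "0 < p" "p < 1"
  shows "neg_bin_mass r p sums 1"
proof -
  have "(\<lambda>k. ((-r) gchoose k) * (-p) ^ k) sums (1 + (-p)) powr (-r)"
    using assms by (intro gen_binomial_real) auto
  then have "(\<lambda>k. (1 - p) powr r * (((-r) gchoose k) * (-p) ^ k)) sums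
      ((1 - p) powr r * (1 + (-p)) powr (-r))"
    by (rule sums_mult)
  moreover have "(1 - p) powr r * (((-r) gchoose k) * (-p) ^ k) = neg_bin_mass r p k" for k
  proof -
    have "r \<notin> \<int>\<^sub>\<le>\<^sub>0"
      using assms by (auto elim!: nonpos_Ints_cases)
    then have "pochhammer r k = Gamma (r + real k) / Gamma r"
      by (rule pochhammer_Gamma)
    then have "(-r) gchoose k = (-1) ^ k * (Gamma (r + real k) / Gamma r) / fact k"
      by (simp add: gbinomial_pochhammer)
    moreover have "(-p) ^ k = (-1) ^ k * p ^ k"
      by (rule power_minus)
    moreover have "(-1) ^ k * (-1) ^ k = (1::real)"
      by (simp flip: power_mult_distrib)
    ultimately show ?thesis
      by (simp add: neg_bin_mass_def field_simps)
  qed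
  moreover have "(1 - p) powr r * (1 + (-p)) powr (-r) = 1"
    using assms by (simp flip: powr_add)
  ultimately show ?thesis by simp
qed

lemma prob_space_neg_bin:
  assumes "r > 0" "0 < p" "p < 1"
  shows "prob_space (density (count_space UNIV) (\<lambda>k. ennreal (neg_bin_mass r p k)))"
proof
  have "(\<integral>\<^sup>+k. ennreal (neg_bin_mass r p k) \<partial>count_space UNIV) = 1"
    using neg_bin_mass_sums[OF assms] neg_bin_mass_nonneg[OF assms]
    by (simp add: nn_integral_count_space_nat suminf_ennreal_eq sums_iff)
  then show "emeasure (density (count_space UNIV) (\<lambda>k. ennreal (neg_bin_mass r p k)))
      (space (density (count_space UNIV) (\<lambda>k. ennreal (neg_bin_mass r p k)))) = 1"
    by (simp add: emeasure_density)
qed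

definition distr_median :: "real measure \<Rightarrow> real" where
  "distr_median D = Inf {x. cdf D x \<ge> 1 / 2}"

text \<open>Samples are indexed from 1; the empirical distribution is meaningful for \<open>n \<ge> 1\<close> only.\<close>
definition empirical_distr :: "nat \<Rightarrow> (nat \<Rightarrow> real) \<Rightarrow> real pmf" where
  "empirical_distr n x = map_pmf x (pmf_of_set {1..n})"

definition sample_median :: "nat \<Rightarrow> (nat \<Rightarrow> real) \<Rightarrow> real" where
  "sample_median n x = distr_median (measure_pmf (empirical_distr n x))"

definition p_hat_R :: "real \<Rightarrow> nat \<Rightarrow> (nat \<Rightarrow> real) \<Rightarrow> real" where
  "p_hat_R r n x = (sample_median n x - 1 / 3) / (sample_median n x - 2 / 3 + r)"

end

theory Submission
  imports Defs
begin

text \<open>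
  The estimator is asymptotically the map \<open>m \<mapsto> m / (m + r)\<close> applied to the sample median \<open>m\<close>, and
  this map sends the mean \<open>r p / (1 - p)\<close> of the negative binomial law exactly to \<open>p\<close>. It is
  therefore enough that the sample median deviates from this mean by at most \<open>\<delta> r\<close>, with high
  probability (\<open>estimator_error_le\<close>).

  The law has variance \<open>r p / (1 - p)\<^sup>2\<close>, of order \<open>r\<close> only, so by Chebyshev a
  single observation lies further than \<open>\<delta> r\<close> from the mean with probability of order \<open>1 / r\<close>. The
  moments come from the size-biasing identity \<open>neg_bin_mass_size_bias\<close>.

  A sample median leaves an interval only if at least half of the sample does. The expected
  fraction of such observations is the probability for a single one, so by Markov's
  inequality half of the sample is outside with probability at most twice this value
  (\<open>prob_half_of_events_le\<close>). This bound is of order \<open>1 / r\<close> uniformly in the sample size \<open>n\<close>; hence it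
  bounds the limit superior over \<open>n\<close> and vanishes as \<open>r \<rightarrow> \<infinity>\<close>. The summand \<open>U\<^sub>i\<close>, almost surely in
  \<open>(0, 1)\<close>, moves every observation by at most 1, which is negligible against \<open>\<delta> r\<close>.
\<close>

section \<open>Mean and variance of the negative binomial law\<close>

text \<open>
  Weighting the law by \<open>k\<close> yields the law with parameter \<open>r + 1\<close>, shifted by one. Each
  factorial moment is thus reduced to the previous one at a larger parameter.
\<close>
lemma neg_bin_mass_size_bias:
  assumes "r > 0" "0 < p" "p < 1"
  shows "real (Suc k) * neg_bin_mass r p (Suc k) = r * p / (1 - p) * neg_bin_mass (r + 1) p k"
proof -
  have G: "Gamma (r + 1) = r * Gamma r"
    using assms by (intro Gamma_plus1) (auto elim!: nonpos_Ints_cases)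
  have Gamma_pos: "Gamma r > 0"
    using assms by (intro Gamma_real_pos)
  have shift: "r + real (Suc k) = r + 1 + real k"
    by simp
  have powr: "(1 - p) powr (r + 1) = (1 - p) powr r * (1 - p)"
    using assms by (simp add: powr_add)
  have "fact (Suc k) = real (Suc k) * fact k"
    by simp
  then show ?thesis
    using assms Gamma_pos unfolding neg_bin_mass_def G shift powr
    by (simp add: divide_simps del: of_nat_Suc fact_Suc)
qed

lemma neg_bin_mean_sums:
  assumes "r > 0" "0 < p" "p < 1"
  shows "(\<lambda>k. real k * neg_bin_mass r p k) sums (r * p / (1 - p))"
proof -
  have "(\<lambda>k. r * p / (1 - p) * neg_bin_mass (r + 1) p k) sums (r * p / (1 - p) * 1)"
    using assms by (intro sums_mult neg_bin_mass_sums) auto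
  then have "(\<lambda>k. real (Suc k) * neg_bin_mass r p (Suc k)) sums (r * p / (1 - p))"
    unfolding neg_bin_mass_size_bias[OF assms] by simp
  from sums_Suc[OF this] show ?thesis
    by simp
qed

lemma neg_bin_second_factorial_moment_sums:
  assumes "r > 0" "0 < p" "p < 1"
  shows "(\<lambda>k. real k * (real k - 1) * neg_bin_mass r p k) sums (r * (r + 1) * (p / (1 - p))\<^sup>2)"
proof -
  have "(\<lambda>k. r * p / (1 - p) * (real k * neg_bin_mass (r + 1) p k)) sums
      (r * p / (1 - p) * ((r + 1) * p / (1 - p)))"
    using assms by (intro sums_mult neg_bin_mean_sums) auto
  moreover have "r * p / (1 - p) * (real k * neg_bin_mass (r + 1) p k)
      = real (Suc k) * (real (Suc k) - 1) * neg_bin_mass r p (Suc k)" for k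
  proof -
    have "real (Suc k) * (real (Suc k) - 1) * neg_bin_mass r p (Suc k)
        = real k * (real (Suc k) * neg_bin_mass r p (Suc k))"
      by simp
    then show ?thesis
      unfolding neg_bin_mass_size_bias[OF assms] by (simp only: mult.left_commute)
  qed
  ultimately have "(\<lambda>k. real (Suc k) * (real (Suc k) - 1) * neg_bin_mass r p (Suc k)) sums
      (r * (r + 1) * (p / (1 - p))\<^sup>2)"
    by (simp add: power2_eq_square mult_ac)
  from sums_Suc[OF this] show ?thesis
    by simp
qed

lemma neg_bin_variance_sums:
  assumes "r > 0" "0 < p" "p < 1"
  shows "(\<lambda>k. (real k - r * p / (1 - p))\<^sup>2 * neg_bin_mass r p k) sums (r * p / (1 - p)\<^sup>2)"
proof -
  define \<mu> where "\<mu> = r * p / (1 - p)"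
  have "(\<lambda>k. real k * (real k - 1) * neg_bin_mass r p k
        + (1 - 2 * \<mu>) * (real k * neg_bin_mass r p k) + \<mu>\<^sup>2 * neg_bin_mass r p k) sums
      (r * (r + 1) * (p / (1 - p))\<^sup>2 + (1 - 2 * \<mu>) * \<mu> + \<mu>\<^sup>2 * 1)"
    using neg_bin_mean_sums[OF assms] neg_bin_second_factorial_moment_sums[OF assms]
      neg_bin_mass_sums[OF assms]
    unfolding \<mu>_def by (intro sums_add sums_mult)
  moreover have "real k * (real k - 1) * neg_bin_mass r p k
        + (1 - 2 * \<mu>) * (real k * neg_bin_mass r p k) + \<mu>\<^sup>2 * neg_bin_mass r p k
      = (real k - \<mu>)\<^sup>2 * neg_bin_mass r p k" for k
    by (simp add: power2_eq_square algebra_simps)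
  moreover have "r * (r + 1) * (p / (1 - p))\<^sup>2 + (1 - 2 * \<mu>) * \<mu> + \<mu>\<^sup>2 * 1 = r * p / (1 - p)\<^sup>2"
  proof -
    define c where "c = p / (1 - p)"
    have "r * p / (1 - p)\<^sup>2 = r * c * (c + 1)"
      using assms by (simp add: c_def power2_eq_square field_simps)
    moreover have "\<mu> = r * c"
      by (simp add: \<mu>_def c_def)
    ultimately show ?thesis
      by (simp add: c_def[symmetric] power2_eq_square algebra_simps)
  qed
  ultimately show ?thesis
    by (simp add: \<mu>_def)
qed

lemma (in prob_space) neg_bin_Chebyshev:
  assumes r: "r > 0" and p: "0 < p" "p < 1" and d: "d > 0"
    and X: "distributed M (count_space UNIV) X (\<lambda>k. ennreal (neg_bin_mass r p k))"
  shows "prob {\<omega> \<in> space M. \<bar>real (X \<omega>) - r * p / (1 - p)\<bar> \<ge> d} \<le> r * p / (1 - p)\<^sup>2 / d\<^sup>2"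
proof -
  let ?f = "\<lambda>k. (real k - r * p / (1 - p))\<^sup>2"
  note nn = neg_bin_mass_nonneg[OF r p] and s = neg_bin_variance_sums[OF r p]
  have int: "integrable (count_space UNIV) (\<lambda>k. neg_bin_mass r p k * ?f k)"
    using s nn by (simp add: integrable_count_space_nat_iff sums_iff mult.commute)
  have "integrable M (\<lambda>\<omega>. ?f (X \<omega>))"
    using distributed_integrable[OF X, of ?f] int nn by simp
  moreover have "expectation (\<lambda>\<omega>. ?f (X \<omega>)) = r * p / (1 - p)\<^sup>2"
    using distributed_integral[OF X, of ?f] int nn s
    by (simp add: integral_count_space_nat sums_iff mult.commute)
  ultimately have "prob {\<omega> \<in> space M. ?f (X \<omega>) \<ge> d\<^sup>2} \<le> r * p / (1 - p)\<^sup>2 / d\<^sup>2"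
    using d integral_Markov_inequality_measure[of M "\<lambda>\<omega>. ?f (X \<omega>)" "{}" "d\<^sup>2"] by simp
  moreover have "?f k \<ge> d\<^sup>2 \<longleftrightarrow> \<bar>real k - r * p / (1 - p)\<bar> \<ge> d" for k
    using d by (metis abs_le_square_iff abs_of_pos)
  ultimately show ?thesis
    by simp
qed

section \<open>The sample median and the majority of the sample\<close>

lemma cdf_empirical_distr:
  assumes "n \<ge> 1"
  shows "cdf (measure_pmf (empirical_distr n x)) t = card {i \<in> {1..n}. x i \<le> t} / n"
proof -
  have "{1..n} \<inter> x -` {..t} = {i \<in> {1..n}. x i \<le> t}"
    by auto
  then show ?thesis
    using assms by (simp add: cdf_def empirical_distr_def measure_pmf_of_set)
qed

lemma sample_median_between:
  assumes majority: "2 * card {i \<in> {1..n}. \<not> (a \<le> x i \<and> x i \<le> b)} < n"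
  shows "a \<le> sample_median n x" "sample_median n x \<le> b"
proof -
  let ?B = "{i \<in> {1..n}. \<not> (a \<le> x i \<and> x i \<le> b)}"
  define S where "S = {t. cdf (measure_pmf (empirical_distr n x)) t \<ge> 1 / 2}"
  have n: "n \<ge> 1"
    using majority by simp
  have S: "t \<in> S \<longleftrightarrow> n \<le> 2 * card {i \<in> {1..n}. x i \<le> t}" for t
    unfolding S_def mem_Collect_eq cdf_empirical_distr[OF n] using n
    by (simp add: field_simps) linarith
  have lower: "a \<le> t" if "t \<in> S" for t
  proof (rule ccontr)
    assume "\<not> a \<le> t"
    then have "card {i \<in> {1..n}. x i \<le> t} \<le> card ?B"
      by (intro card_mono) auto
    with that majority show False
      by (simp add: S)
  qed
  have "b \<in> S"
  proof -
    have "n \<le> card ({i \<in> {1..n}. x i \<le> b} \<union> ?B)"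
      using card_mono[of "{i \<in> {1..n}. x i \<le> b} \<union> ?B" "{1..n}"] by fastforce
    also have "\<dots> \<le> card {i \<in> {1..n}. x i \<le> b} + card ?B"
      by (rule card_Un_le)
    finally show ?thesis
      using majority by (simp add: S)
  qed
  have med: "sample_median n x = Inf S"
    by (simp add: sample_median_def distr_median_def S_def)
  show "a \<le> sample_median n x"
    unfolding med using \<open>b \<in> S\<close> lower by (intro cInf_greatest) auto
  show "sample_median n x \<le> b"
    unfolding med using \<open>b \<in> S\<close> lower by (intro cInf_lower bdd_belowI) auto
qed

text \<open>
  By linearity, the number of events that occur has expectation at most \<open>n c\<close> with \<open>n = card I\<close>, so
  Markov's inequality at the level \<open>n / 2\<close> yields a bound free of \<open>n\<close>.
\<close>
lemma (in prob_space) prob_half_of_events_le: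
  assumes I: "finite I" "I \<noteq> {}"
    and B: "\<And>i. i \<in> I \<Longrightarrow> B i \<in> events" "\<And>i. i \<in> I \<Longrightarrow> prob (B i) \<le> c"
  shows "prob {\<omega> \<in> space M. card I \<le> 2 * card {i \<in> I. \<omega> \<in> B i}} \<le> 2 * c"
proof -
  define N where "N = (\<lambda>\<omega>. \<Sum>i\<in>I. indicator (B i) \<omega> :: real)"
  have N_card: "N \<omega> = card {i \<in> I. \<omega> \<in> B i}" for \<omega>
    using I by (simp add: N_def indicator_def sum.If_cases Int_def)
  have pos: "real (card I) > 0"
    using I by (simp add: card_gt_0_iff)
  have "integrable M N"
    unfolding N_def using B by (intro Bochner_Integration.integrable_sum)
      (auto simp: less_top[symmetric])
  then have "prob {\<omega> \<in> space M. N \<omega> \<ge> card I / 2} \<le> expectation N / (card I / 2)"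
    using pos by (intro integral_Markov_inequality_measure[where A = "{}"]) (auto simp: N_def sum_nonneg)
  also have "expectation N = (\<Sum>i\<in>I. prob (B i))"
    unfolding N_def using B by (subst Bochner_Integration.integral_sum)
      (auto simp: less_top[symmetric])
  also have "\<dots> / (card I / 2) \<le> (card I * c) / (card I / 2)"
    using B pos by (intro divide_right_mono sum_bounded_above) auto
  also have "\<dots> = 2 * c"
    using pos by simp
  also have "{\<omega> \<in> space M. N \<omega> \<ge> card I / 2} = {\<omega> \<in> space M. card I \<le> 2 * card {i \<in> I. \<omega> \<in> B i}}"
    unfolding N_card by (auto simp: field_simps; linarith)
  finally show ?thesis .
qed

section \<open>Consistency of the estimator\<close>

text \<open>
  After clearing the denominator the error is \<open>(1 - p) (m - r p / (1 - p)) + (2 p - 1) / 3\<close>,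
  of size at most \<open>\<delta> r + 2\<close>, over \<open>m - 2 / 3 + r\<close>, which is at least \<open>r / 4\<close>.
\<close>
lemma estimator_error_le:
  fixes p r m \<delta> \<epsilon> :: real
  assumes p: "0 < p" "p < 1" and \<delta>: "0 < \<delta>" "\<delta> \<le> 1 / 2" "8 * \<delta> \<le> \<epsilon>" and r: "r \<ge> 3" "r * \<epsilon> \<ge> 16"
    and m: "r * p / (1 - p) - \<delta> * r \<le> m" "m \<le> r * p / (1 - p) + \<delta> * r + 1"
  shows "\<bar>(m - 1 / 3) / (m - 2 / 3 + r) - p\<bar> \<le> \<epsilon>"
proof -
  define \<mu> where "\<mu> = r * p / (1 - p)"
  have \<mu>: "(1 - p) * \<mu> = p * r" "\<mu> > 0"
    using p r by (simp_all add: \<mu>_def)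
  have "\<delta> * r \<le> r / 2"
    using mult_right_mono[OF \<delta>(2), of r] r by simp
  then have den: "m - 2 / 3 + r \<ge> r / 4"
    using m \<mu>(2) r(1) unfolding \<mu>_def[symmetric] by linarith
  have "\<bar>(1 - p) * (m - \<mu>)\<bar> = (1 - p) * \<bar>m - \<mu>\<bar>"
    using p by (simp add: abs_mult)
  also have "\<dots> \<le> \<bar>m - \<mu>\<bar>"
    using p mult_right_mono[of "1 - p" 1 "\<bar>m - \<mu>\<bar>"] by simp
  also have "\<dots> \<le> \<delta> * r + 1"
  proof -
    have "\<delta> * r \<ge> 0"
      using \<delta> r by simp
    then show ?thesis
      using m unfolding \<mu>_def[symmetric] by linarith
  qed
  finally have "\<bar>(1 - p) * (m - \<mu>)\<bar> \<le> \<delta> * r + 1" .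
  moreover have "\<bar>(2 * p - 1) / 3\<bar> \<le> 1"
    using p by simp
  ultimately have "\<bar>(1 - p) * (m - \<mu>) + (2 * p - 1) / 3\<bar> \<le> (\<delta> * r + 1) + 1"
    by (rule order_trans[OF abs_triangle_ineq add_mono])
  then have "\<bar>(1 - p) * (m - \<mu>) + (2 * p - 1) / 3\<bar> \<le> \<delta> * r + 2"
    by (simp only: add.assoc one_add_one)
  moreover have "(m - 1 / 3) - p * (m - 2 / 3 + r) = (1 - p) * (m - \<mu>) + (2 * p - 1) / 3"
    unfolding right_diff_distrib[of "1 - p"] \<mu>(1) by (simp add: field_simps)
  moreover have "\<delta> * r + 2 \<le> \<epsilon> * (r / 4)"
  proof -
    have "8 * \<delta> * r \<le> \<epsilon> * r"
      using \<delta>(3) r(1) by (intro mult_right_mono) auto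
    then show ?thesis
      using r(2) by (simp add: mult_ac)
  qed
  moreover have "\<epsilon> * (r / 4) \<le> \<epsilon> * (m - 2 / 3 + r)"
    using den \<delta> by (intro mult_left_mono) auto
  ultimately have "\<bar>(m - 1 / 3) - p * (m - 2 / 3 + r)\<bar> \<le> \<epsilon> * (m - 2 / 3 + r)"
    by linarith
  moreover have "m - 2 / 3 + r > 0"
    using den r by linarith
  moreover from this have "(m - 1 / 3) / (m - 2 / 3 + r) - p
      = ((m - 1 / 3) - p * (m - 2 / 3 + r)) / (m - 2 / 3 + r)"
    by (simp add: diff_divide_distrib)
  ultimately show ?thesis
    by (simp only: abs_divide abs_of_pos pos_divide_le_eq)
qed

theorem corollary1:
  fixes p :: real
    and M :: "real \<Rightarrow> 'a measure"
    and K :: "real \<Rightarrow> nat \<Rightarrow> 'a \<Rightarrow> nat"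
    and U :: "real \<Rightarrow> nat \<Rightarrow> 'a \<Rightarrow> real"
  assumes p: "0 < p" "p < 1"
    and M: "\<And>r. r > 0 \<Longrightarrow> prob_space (M r)"
    and K_distr: "\<And>r i. r > 0 \<Longrightarrow> i \<ge> 1 \<Longrightarrow>
      distributed (M r) (count_space UNIV) (K r i) (\<lambda>k. ennreal (neg_bin_mass r p k))"
    and K_indep: "\<And>r. r > 0 \<Longrightarrow>
      prob_space.indep_vars (M r) (\<lambda>_. count_space UNIV) (K r) {1..}"
    and U_distr: "\<And>r i. r > 0 \<Longrightarrow> i \<ge> 1 \<Longrightarrow>
      distributed (M r) lborel (U r i) (\<lambda>x. ennreal (indicator {0<..<1} x))"
    and U_indep: "\<And>r. r > 0 \<Longrightarrow>
      prob_space.indep_vars (M r) (\<lambda>_. borel) (U r) {1..}"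
    and KU_indep: "\<And>r. r > 0 \<Longrightarrow>
      prob_space.indep_var (M r)
        (Pi\<^sub>M {1..} (\<lambda>_. borel)) (\<lambda>\<omega>. \<lambda>i\<in>{1..}. real (K r i \<omega>))
        (Pi\<^sub>M {1..} (\<lambda>_. borel)) (\<lambda>\<omega>. \<lambda>i\<in>{1..}. U r i \<omega>)"
  shows "\<forall>\<epsilon>>0. ((\<lambda>r. limsup (\<lambda>n. ereal (measure (M r)
      {\<omega> \<in> space (M r). \<bar>p_hat_R r n (\<lambda>i. real (K r i \<omega>) + U r i \<omega>) - p\<bar> > \<epsilon>})))
    \<longlongrightarrow> 0) at_top"
proof (intro allI impI)
  fix \<epsilon> :: real
  assume \<epsilon>: "\<epsilon> > 0"
  define \<delta> where "\<delta> = min (1 / 2) (\<epsilon> / 8)"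
  have \<delta>: "0 < \<delta>" "\<delta> \<le> 1 / 2" "8 * \<delta> \<le> \<epsilon>"
    using \<epsilon> by (auto simp: \<delta>_def)
  define C where "C = 2 * (p / (1 - p)\<^sup>2 / \<delta>\<^sup>2)"
  let ?err = "\<lambda>r n. {\<omega> \<in> space (M r). \<bar>p_hat_R r n (\<lambda>i. real (K r i \<omega>) + U r i \<omega>) - p\<bar> > \<epsilon>}"
  have err_le: "measure (M r) (?err r n) \<le> C / r"
    if r: "r \<ge> 3" "r * \<epsilon> \<ge> 16" and n: "n \<ge> 1" for r and n :: nat
  proof -
    have r0: "r > 0"
      using r by simp
    interpret prob_space "M r"
      using M[OF r0] .
    define \<mu> where "\<mu> = r * p / (1 - p)"
    define B where "B = (\<lambda>i. {\<omega> \<in> space (M r). \<bar>real (K r i \<omega>) - \<mu>\<bar> \<ge> \<delta> * r})"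
    define E where "E = {\<omega> \<in> space (M r). card {1..n} \<le> 2 * card {i \<in> {1..n}. \<omega> \<in> B i}}"
    have B_events: "B i \<in> events" if "i \<in> {1..n}" for i
    proof -
      have [measurable]: "K r i \<in> M r \<rightarrow>\<^sub>M count_space UNIV"
        using K_distr[OF r0, of i] that by (simp add: distributed_def)
      show ?thesis
        unfolding B_def by measurable
    qed
    have B_prob: "prob (B i) \<le> p / (1 - p)\<^sup>2 / \<delta>\<^sup>2 / r" if "i \<in> {1..n}" for i
    proof -
      have "prob (B i) \<le> r * p / (1 - p)\<^sup>2 / (\<delta> * r)\<^sup>2"
        unfolding B_def \<mu>_def using r0 p \<delta> K_distr[OF r0, of i] that
        by (intro neg_bin_Chebyshev) auto
      also have "\<dots> = p / (1 - p)\<^sup>2 / \<delta>\<^sup>2 / r"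
        using r0 by (simp add: power2_eq_square)
      finally show ?thesis .
    qed
    have "prob E \<le> 2 * (p / (1 - p)\<^sup>2 / \<delta>\<^sup>2 / r)"
      unfolding E_def using n B_events B_prob by (intro prob_half_of_events_le) auto
    then have E_prob: "prob E \<le> C / r"
      by (simp add: C_def)
    have E_events: "E \<in> events"
    proof -
      have [measurable]: "B i \<in> events" if "i \<in> {1..n}" for i
        using B_events[OF that] .
      have "{\<omega> \<in> space (M r). real (card {1..n}) \<le> 2 * (\<Sum>i\<in>{1..n}. indicator (B i) \<omega>)} \<in> events"
        by measurable
      also have "{\<omega> \<in> space (M r). real (card {1..n}) \<le> 2 * (\<Sum>i\<in>{1..n}. indicator (B i) \<omega>)} = E"
        by (auto simp: E_def indicator_def sum.If_cases Int_def)
      finally show ?thesis .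
    qed
    have U_AE: "AE \<omega> in M r. \<forall>i\<in>{1..n}. U r i \<omega> \<in> {0<..<1}"
    proof (rule AE_finite_allI)
      fix i assume "i \<in> {1..n}"
      then have U: "distributed (M r) lborel (U r i) (\<lambda>x. ennreal (indicator {0<..<1} x))"
        using U_distr[OF r0, of i] by simp
      have "AE x in density lborel (\<lambda>x. ennreal (indicator {0<..<1} x)). x \<in> {0<..<(1::real)}"
        by (subst AE_density) (auto simp: indicator_def)
      then have "AE x in distr (M r) lborel (U r i). x \<in> {0<..<1}"
        by (simp only: distributed_distr_eq_density[OF U])
      then show "AE \<omega> in M r. U r i \<omega> \<in> {0<..<1}"
        using distributed_measurable[OF U] by (subst (asm) AE_distr_iff) auto
    qed simp
    have "AE \<omega> in M r. \<omega> \<in> ?err r n \<longrightarrow> \<omega> \<in> E"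
      using U_AE
    proof eventually_elim
      case (elim \<omega>)
      show ?case
      proof (rule impI, rule ccontr)
        assume \<omega>: "\<omega> \<in> ?err r n" "\<omega> \<notin> E"
        let ?x = "\<lambda>i. real (K r i \<omega>) + U r i \<omega>"
        \<comment> \<open>As \<open>U\<^sub>i\<close> is in \<open>(0, 1)\<close>, enlarging the interval by 1 on the right absorbs it, and the
          count of outliers is governed by the integer parts \<open>K\<^sub>i\<close>.\<close>
        have "{i \<in> {1..n}. \<not> (\<mu> - \<delta> * r \<le> ?x i \<and> ?x i \<le> \<mu> + \<delta> * r + 1)}
            \<subseteq> {i \<in> {1..n}. \<omega> \<in> B i}"
          using elim \<omega>(1) by (force simp: B_def)
        then have "card {i \<in> {1..n}. \<not> (\<mu> - \<delta> * r \<le> ?x i \<and> ?x i \<le> \<mu> + \<delta> * r + 1)}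
            \<le> card {i \<in> {1..n}. \<omega> \<in> B i}"
          by (intro card_mono) auto
        moreover have "2 * card {i \<in> {1..n}. \<omega> \<in> B i} < n"
          using \<omega> by (auto simp: E_def)
        ultimately have "2 * card {i \<in> {1..n}. \<not> (\<mu> - \<delta> * r \<le> ?x i \<and> ?x i \<le> \<mu> + \<delta> * r + 1)} < n"
          by linarith
        from sample_median_between[OF this] have "\<bar>p_hat_R r n ?x - p\<bar> \<le> \<epsilon>"
          unfolding p_hat_R_def \<mu>_def using p \<delta> r by (intro estimator_error_le) auto
        with \<omega>(1) show False
          by simp
      qed
    qed
    then have "prob (?err r n) \<le> prob E"
      using E_events by (rule finite_measure_mono_AE)
    with E_prob show ?thesis
      by simp
  qed
  have upper: "\<forall>\<^sub>F r in at_top. limsup (\<lambda>n. ereal (measure (M r) (?err r n))) \<le> ereal (C / r)"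
    using eventually_ge_at_top[of 3] eventually_ge_at_top[of "16 / \<epsilon>"]
  proof eventually_elim
    case (elim r)
    then have "r * \<epsilon> \<ge> 16"
      using \<epsilon> by (simp add: field_simps)
    with elim(1) show ?case
      by (intro Limsup_bounded eventually_mono[OF eventually_ge_at_top[of 1]]) (auto intro: err_le)
  qed
  have lower: "\<forall>\<^sub>F r in at_top. 0 \<le> limsup (\<lambda>n. ereal (measure (M r) (?err r n)))"
    by (intro always_eventually allI le_Limsup) auto
  have vanishing: "((\<lambda>r. ereal (C / r)) \<longlongrightarrow> 0) at_top"
    unfolding zero_ereal_def
    by (intro tendsto_ereal tendsto_divide_0[OF tendsto_const] filterlim_at_top_imp_at_infinity
        filterlim_ident)
  show "((\<lambda>r. limsup (\<lambda>n. ereal (measure (M r) (?err r n)))) \<longlongrightarrow> 0) at_top"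
    by (rule tendsto_sandwich[OF lower upper tendsto_const vanishing])
qed

end
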